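(* Let $\mathcal{S}$ be a scenario with startperiod $A_M$, startphase $B_M$, endperiod $A_N$ and endphase $B_N$, and let $\mathcal{S}' = \mathcal{S}s$ be the scenario obtained by adding one operation s at the end of $\mathcal{S}$, with startperiod $A'_M$, startphase $B'_M$, endperiod $A'_N$ and endphase $B'_N$. If $\tfrac12(3B_N-1)$ is odd, then $$A'_M = 2A_M,\quad B'_M = B_M,\quad A'_N = 3A_N,\quad B'_N = \tfrac12(3B_N-1).$$ If $\tfrac12(3B_N-1)$ is even, then $$A'_M = 2A_M,\quad B'_M = B_M + A_M,\quad A'_N = 3A_N,\quad B'_N = \tfrac12(3B_N+3A_N-1).$$
   Context: Collatz operations on positive integers: "s" (spike) is $m\mapsto (3m+1)/2$, applied when $m$ is odd; "d" (down) is $m\mapsto m/2$, applied when $m$ is even. A scenario is a finite nonempty word in the letters s and d whose first letter is s. A realization of a scenario is a sequence of positive integers obtained from a positive odd integer $M$ (the startnumber) by performing, from left to right, the operations spelled out by the word, where at each step s is applied to an odd integer and d to an even integer, and where the final integer $N$ (the endnumber) is odd. A scenario uniquely determines integers $A_M, A_N$ (even) and $B_M, B_N$ (odd) such that, for $k=1,2,3,\dots$, the $k$-th realization (all realizations being listed in increasing order of startnumber) has startnumber $M_k=A_M k-B_M$ and endnumber $N_k=A_N k-B_N$. The integers $A_M$, $A_N$, $B_M$, $B_N$ are called the startperiod, endperiod, startphase and endphase, respectively. *)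

theory Defs
  imports Main
begin

datatype collatz_op = Spike | Down

fun applicable :: "collatz_op \<Rightarrow> int \<Rightarrow> bool" where
  "applicable Spike m \<longleftrightarrow> odd m"
| "applicable Down m \<longleftrightarrow> even m"

(* Under applicability both divisions are exact. *)
fun apply_op :: "collatz_op \<Rightarrow> int \<Rightarrow> int" where
  "apply_op Spike m = (3 * m + 1) div 2"
| "apply_op Down m = m div 2"

definition scenario :: "collatz_op list \<Rightarrow> bool" where
  "scenario w \<longleftrightarrow> w \<noteq> [] \<and> hd w = Spike"

definition realization :: "collatz_op list \<Rightarrow> int list \<Rightarrow> bool" where
  "realization w xs \<longleftrightarrow>
     length xs = Suc (length w) \<and> (\<forall>x \<in> set xs. x > 0) \<and>
     odd (hd xs) \<and> odd (last xs) \<and>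
     (\<forall>i < length w. applicable (w ! i) (xs ! i) \<and> xs ! Suc i = apply_op (w ! i) (xs ! i))"

(* R 1, R 2, ... lists all realizations of w, ordered by startnumber. *)
definition lists_realizations :: "collatz_op list \<Rightarrow> (nat \<Rightarrow> int list) \<Rightarrow> bool" where
  "lists_realizations w R \<longleftrightarrow>
     R ` {1..} = {xs. realization w xs} \<and> strict_mono_on {1..} (\<lambda>k. hd (R k))"

definition has_periods_phases :: "collatz_op list \<Rightarrow> int \<Rightarrow> int \<Rightarrow> int \<Rightarrow> int \<Rightarrow> bool" where
  "has_periods_phases w A\<^sub>M B\<^sub>M A\<^sub>N B\<^sub>N \<longleftrightarrow>
     even A\<^sub>M \<and> odd B\<^sub>M \<and> even A\<^sub>N \<and> odd B\<^sub>N \<and>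
     (\<exists>R. lists_realizations w R \<and>
       (\<forall>k\<ge>1. hd (R k) = A\<^sub>M * int k - B\<^sub>M \<and> last (R k) = A\<^sub>N * int k - B\<^sub>N))"

(* For scenarios these descriptions are proper: see ex1_periods_phases below. *)
definition startperiod :: "collatz_op list \<Rightarrow> int" where
  "startperiod w = (THE A\<^sub>M. \<exists>B\<^sub>M A\<^sub>N B\<^sub>N. has_periods_phases w A\<^sub>M B\<^sub>M A\<^sub>N B\<^sub>N)"

definition startphase :: "collatz_op list \<Rightarrow> int" where
  "startphase w = (THE B\<^sub>M. \<exists>A\<^sub>M A\<^sub>N B\<^sub>N. has_periods_phases w A\<^sub>M B\<^sub>M A\<^sub>N B\<^sub>N)"

definition endperiod :: "collatz_op list \<Rightarrow> int" where
  "endperiod w = (THE A\<^sub>N. \<exists>A\<^sub>M B\<^sub>M B\<^sub>N. has_periods_phases w A\<^sub>M B\<^sub>M A\<^sub>N B\<^sub>N)"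

definition endphase :: "collatz_op list \<Rightarrow> int" where
  "endphase w = (THE B\<^sub>N. \<exists>A\<^sub>M B\<^sub>M A\<^sub>N. has_periods_phases w A\<^sub>M B\<^sub>M A\<^sub>N B\<^sub>N)"

lemma lists_realizations_unique:
  assumes R: "lists_realizations w R" and Q: "lists_realizations w Q" and "k \<ge> 1"
  shows "R k = Q k"
  using \<open>k \<ge> 1\<close>
proof (induction k rule: less_induct)
  case (less k)
  have im: "R ` {1..} = Q ` {1..}"
    using R Q by (simp add: lists_realizations_def)
  have mR: "i < j \<Longrightarrow> hd (R i) < hd (R j)" if "1 \<le> i" for i j
    using R that by (auto simp: lists_realizations_def strict_mono_on_def)
  have mQ: "i < j \<Longrightarrow> hd (Q i) < hd (Q j)" if "1 \<le> i" for i j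
    using Q that by (auto simp: lists_realizations_def strict_mono_on_def)
  have "R k \<in> Q ` {1..}" using im less.prems by auto
  then obtain j where j: "j \<ge> 1" "R k = Q j" by auto
  have "Q k \<in> R ` {1..}" using im less.prems by auto
  then obtain i where i: "i \<ge> 1" "Q k = R i" by auto
  have "\<not> j < k" using less.IH[of j] j mR[of j k] by auto
  moreover have "\<not> i < k" using less.IH[of i] i mQ[of i k] by auto
  moreover have "\<not> (j > k \<and> i > k)"
    using mQ[of k j] mR[of k i] i j less.prems by auto
  ultimately have "j = k \<or> i = k" by linarith
  then show ?case using i j by auto
qed

lemma has_periods_phases_unique:
  assumes "has_periods_phases w a b c d" and "has_periods_phases w a' b' c' d'"
  shows "a = a' \<and> b = b' \<and> c = c' \<and> d = d'"
proof -
  obtain R where R: "lists_realizations w R"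
    "\<And>k. k \<ge> 1 \<Longrightarrow> hd (R k) = a * int k - b \<and> last (R k) = c * int k - d"
    using assms(1) by (auto simp: has_periods_phases_def)
  obtain Q where Q: "lists_realizations w Q"
    "\<And>k. k \<ge> 1 \<Longrightarrow> hd (Q k) = a' * int k - b' \<and> last (Q k) = c' * int k - d'"
    using assms(2) by (auto simp: has_periods_phases_def)
  have "R 1 = Q 1" "R 2 = Q 2"
    using lists_realizations_unique[OF R(1) Q(1)] by auto
  with R(2)[of 1] R(2)[of 2] Q(2)[of 1] Q(2)[of 2] show ?thesis by simp
qed

(* realization without the parity conditions on the two ends; used only for the existence proof *)
definition orbit :: "collatz_op list \<Rightarrow> int list \<Rightarrow> bool" where
  "orbit w xs \<longleftrightarrow> length xs = Suc (length w) \<and> (\<forall>x \<in> set xs. x > 0) \<and>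
     (\<forall>i < length w. applicable (w ! i) (xs ! i) \<and> xs ! Suc i = apply_op (w ! i) (xs ! i))"

lemma orbit_snoc:
  "orbit (w @ [p]) zs \<longleftrightarrow>
     (\<exists>xs. orbit w xs \<and> applicable p (last xs) \<and> zs = xs @ [apply_op p (last xs)])"
  (is "?L \<longleftrightarrow> ?R")
proof
  assume L: ?L
  then have len: "length zs = Suc (Suc (length w))" by (simp add: orbit_def)
  then obtain xs z where zs: "zs = xs @ [z]"
    by (metis length_Suc_conv_rev)
  have lx: "length xs = Suc (length w)" using len zs by simp
  then have lst: "last xs = xs ! length w"
    by (metis diff_Suc_1 last_conv_nth length_0_conv nat.distinct(1))
  have st: "applicable ((w @ [p]) ! i) (zs ! i) \<and> zs ! Suc i = apply_op ((w @ [p]) ! i) (zs ! i)"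
    if "i \<le> length w" for i
    using L that by (simp add: orbit_def)
  have "orbit w xs"
    unfolding orbit_def
  proof (intro conjI allI impI)
    show "length xs = Suc (length w)" by fact
    show "\<forall>x \<in> set xs. x > 0" using L zs by (simp add: orbit_def)
    fix i assume "i < length w"
    then show "applicable (w ! i) (xs ! i)" "xs ! Suc i = apply_op (w ! i) (xs ! i)"
      using st[of i] lx zs by (auto simp: nth_append)
  qed
  moreover have "applicable p (last xs) \<and> z = apply_op p (last xs)"
    using st[of "length w"] lx zs lst by (simp add: nth_append)
  ultimately show ?R using zs by auto
next
  assume ?R
  then obtain xs where xs: "orbit w xs" "applicable p (last xs)"
    "zs = xs @ [apply_op p (last xs)]" by auto
  have lx: "length xs = Suc (length w)" using xs by (simp add: orbit_def)
  then have lst: "last xs = xs ! length w"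
    by (metis diff_Suc_1 last_conv_nth length_0_conv nat.distinct(1))
  have "last xs > 0" using xs(1) lx
    by (metis last_in_set length_0_conv nat.distinct(1) orbit_def)
  then have pos: "apply_op p (last xs) > 0"
    using xs(2) by (cases p) (auto elim!: evenE)
  show ?L
    unfolding orbit_def
  proof (intro conjI allI impI)
    show "length zs = Suc (length (w @ [p]))" using lx xs by simp
    show "\<forall>x \<in> set zs. x > 0" using xs pos by (auto simp: orbit_def)
    fix i assume "i < length (w @ [p])"
    then have "i < length w \<or> i = length w" by auto
    then show "applicable ((w @ [p]) ! i) (zs ! i)"
      "zs ! Suc i = apply_op ((w @ [p]) ! i) (zs ! i)"
      using xs lx lst by (auto simp: nth_append orbit_def)
  qed
qed

lemma parity_split:
  fixes a c :: int
  assumes "odd a" "0 < a"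
  shows "\<exists>e\<in>{0,1}. \<forall>j. (even (a * j + c) = P) \<longleftrightarrow> (\<exists>i. j = 2 * i + e)"
proof -
  have odd_iff: "odd j \<longleftrightarrow> (\<exists>i. j = 2 * i + 1)" for j :: int by (auto elim: oddE)
  show ?thesis
  proof (cases "even c = P")
    case True
    have "\<forall>j. (even (a * j + c) = P) \<longleftrightarrow> (\<exists>i. j = 2 * i + 0)"
      using True assms by (auto elim!: evenE)
    then show ?thesis by blast
  next
    case False
    have "\<forall>j. (even (a * j + c) = P) \<longleftrightarrow> (\<exists>i. j = 2 * i + 1)"
      using False assms odd_iff by (simp only: even_add even_mult_iff) auto
    then show ?thesis by blast
  qed
qed

lemma orbit_param:
  "\<exists>f b c (a::int) m. odd a \<and> a > 0 \<and> m > 0 \<and>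
     {xs. orbit w xs} = f ` {0::int..} \<and>
     (\<forall>j\<ge>0. hd (f j) = m * j + b \<and> last (f j) = a * j + c) \<and> (w \<noteq> [] \<longrightarrow> even m)"
proof (induction w rule: rev_induct)
  case Nil
  have "{xs. orbit [] xs} = (\<lambda>j. [j + 1]) ` {0::int..}"
  proof (intro set_eqI iffI)
    fix xs :: "int list" assume "xs \<in> {xs. orbit [] xs}"
    then obtain x where "xs = [x]" "x > 0" by (auto simp: orbit_def length_Suc_conv)
    then have "xs = (\<lambda>j. [j + 1]) (x - 1)" "x - 1 \<in> {0..}" by auto
    then show "xs \<in> (\<lambda>j. [j + 1]) ` {0::int..}" by blast
  qed (auto simp: orbit_def)
  then show ?case
    by (intro exI[of _ "\<lambda>j. [j + 1]"] exI[of _ 1]) auto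
next
  case (snoc p w)
  then obtain f b c a m where f: "odd (a::int)" "a > 0" "m > 0" "{xs. orbit w xs} = f ` {0::int..}"
    "\<And>j. j \<ge> 0 \<Longrightarrow> hd (f j) = m * j + b \<and> last (f j) = a * j + c" by blast
  have ap: "applicable p x \<longleftrightarrow> even x = (p = Down)" for x by (cases p) auto
  obtain e where e: "e \<in> {0,1}" "\<And>j. applicable p (a * j + c) \<longleftrightarrow> (\<exists>i. j = 2 * i + e)"
    using parity_split[OF f(1,2), of c "p = Down"] unfolding ap by blast
  define g where "g i = f (2 * i + e) @ [apply_op p (last (f (2 * i + e)))]" for i
  have ne: "f j \<noteq> []" if "j \<ge> 0" for j
  proof -
    have "orbit w (f j)" using f(4) that by blast
    then show ?thesis by (auto simp: orbit_def)
  qed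
  have "{zs. orbit (w @ [p]) zs} = g ` {0..}"
  proof (intro set_eqI iffI)
    fix zs assume "zs \<in> {zs. orbit (w @ [p]) zs}"
    then obtain xs where xs: "orbit w xs" "applicable p (last xs)"
      "zs = xs @ [apply_op p (last xs)]" by (auto simp: orbit_snoc)
    then obtain j where j: "j \<ge> 0" "xs = f j" using f(4) by auto
    then obtain i where "j = 2 * i + e" using xs f(5) e(2) by auto
    then have "i \<ge> 0" "zs = g i" using j e(1) xs by (auto simp: g_def)
    then show "zs \<in> g ` {0..}" by auto
  next
    fix zs assume "zs \<in> g ` {0..}"
    then obtain i where i: "i \<ge> 0" "zs = g i" by auto
    have j: "2 * i + e \<ge> 0" using i e by auto
    then have "orbit w (f (2 * i + e))" using f(4) by blast
    moreover have "applicable p (last (f (2 * i + e)))" using f(5)[OF j] e(2) by auto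
    ultimately show "zs \<in> {zs. orbit (w @ [p]) zs}"
      using i by (auto simp: orbit_snoc g_def)
  qed
  moreover have "hd (g i) = (2 * m) * i + (m * e + b)" if "i \<ge> 0" for i
    using f(5)[of "2 * i + e"] ne[of "2 * i + e"] e(1) that by (auto simp: g_def algebra_simps)
  moreover have "\<exists>a' c'. odd (a'::int) \<and> a' > 0 \<and> (\<forall>i\<ge>0. last (g i) = a' * i + c')"
  proof -
    have l: "last (g i) = apply_op p (2 * (a * i) + (a * e + c))" if "i \<ge> 0" for i
      using f(5)[of "2 * i + e"] e(1) that by (auto simp: g_def algebra_simps)
    show ?thesis
    proof (cases p)
      case Spike
      have "apply_op p (2 * (a * i) + (a * e + c)) = (3 * a) * i + (3 * (a * e + c) + 1) div 2" for i
      proof -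
        have "3 * (2 * (a * i) + (a * e + c)) + 1 = (3 * (a * e + c) + 1) + 2 * (3 * a * i)" by simp
        then show ?thesis unfolding Spike apply_op.simps by simp
      qed
      then show ?thesis using l f(1,2)
        by (intro exI[of _ "3 * a"] exI[of _ "(3 * (a * e + c) + 1) div 2"]) auto
    next
      case Down
      have "apply_op p (2 * (a * i) + (a * e + c)) = a * i + (a * e + c) div 2" for i
        by (simp add: Down)
      then show ?thesis using l f(1,2)
        by (intro exI[of _ a] exI[of _ "(a * e + c) div 2"]) auto
    qed
  qed
  then obtain a' c' where "odd (a'::int)" "a' > 0" "\<forall>i\<ge>0. last (g i) = a' * i + c'" by blast
  ultimately show ?case using f(3)
    by (intro exI[of _ g] exI[of _ "m * e + b"] exI[of _ c'] exI[of _ a'] exI[of _ "2 * m"]) auto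
qed

lemma ex_periods_phases:
  assumes "scenario w"
  shows "\<exists>A\<^sub>M B\<^sub>M A\<^sub>N B\<^sub>N. has_periods_phases w A\<^sub>M B\<^sub>M A\<^sub>N B\<^sub>N"
proof -
  obtain f b c a m where f: "odd (a::int)" "a > 0" "m > 0" "{xs. orbit w xs} = f ` {0::int..}"
    "\<And>j. j \<ge> 0 \<Longrightarrow> hd (f j) = m * j + b \<and> last (f j) = a * j + c" "w \<noteq> [] \<longrightarrow> even m"
    using orbit_param[of w] by blast
  have w: "w \<noteq> []" "w ! 0 = Spike" using assms by (auto simp: scenario_def hd_conv_nth)
  then have "even m" using f by simp
  have hdodd: "odd (hd xs)" if "orbit w xs" for xs
  proof -
    have "applicable (w ! 0) (xs ! 0)" "xs \<noteq> []" using that w by (auto simp: orbit_def)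
    then show ?thesis using w by (simp add: hd_conv_nth)
  qed
  then have real: "realization w xs \<longleftrightarrow> orbit w xs \<and> odd (last xs)" for xs
    by (auto simp: orbit_def realization_def)
  have not_even: "even x = False \<longleftrightarrow> odd x" for x :: int by simp
  obtain e where e: "e \<in> {0,1}" "\<And>j. odd (a * j + c) \<longleftrightarrow> (\<exists>i. j = 2 * i + e)"
    using parity_split[OF f(1,2), of c False] unfolding not_even by blast
  define R where "R k = f (2 * (int k - 1) + e)" for k
  have h: "hd (R k) = (2 * m) * int k - (2 * m - m * e - b) \<and>
      last (R k) = (2 * a) * int k - (2 * a - a * e - c)" if "k \<ge> 1" for k
    using f(5)[of "2 * (int k - 1) + e"] e(1) that by (auto simp: R_def algebra_simps)
  have im: "R ` {1..} = {xs. realization w xs}"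
  proof (intro set_eqI iffI)
    fix xs assume "xs \<in> R ` {1..}"
    then obtain k where k: "k \<ge> 1" "xs = R k" by auto
    then have nn: "2 * (int k - 1) + e \<ge> 0" using e by auto
    then have "orbit w xs" using f(4) k by (auto simp: R_def)
    moreover have "odd (last xs)" using f(5)[OF nn] e(2) k by (auto simp: R_def)
    ultimately show "xs \<in> {xs. realization w xs}" by (simp add: real)
  next
    fix xs assume "xs \<in> {xs. realization w xs}"
    then have xs: "orbit w xs" "odd (last xs)" by (auto simp: real)
    then obtain j where j: "j \<ge> 0" "xs = f j" using f(4) by auto
    then obtain i where i: "j = 2 * i + e" using xs f(5) e(2) by auto
    then have "i \<ge> 0" using j e(1) by auto
    then have "xs = R (nat (i + 1))" "nat (i + 1) \<ge> 1" using i j by (auto simp: R_def)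
    then show "xs \<in> R ` {1..}" by auto
  qed
  have "strict_mono_on {1..} (\<lambda>k. hd (R k))"
    using f(3) h by (auto simp: strict_mono_on_def)
  with im have "lists_realizations w R" by (simp add: lists_realizations_def)
  moreover have "odd (2 * m - m * e - b)" "odd (2 * a - a * e - c)"
  proof -
    have "R 1 \<in> {xs. realization w xs}" using im by auto
    then have "odd (hd (R 1))" "odd (last (R 1))" by (auto simp: realization_def)
    then show "odd (2 * m - m * e - b)" "odd (2 * a - a * e - c)" using h[of 1] by auto
  qed
  ultimately have "has_periods_phases w (2 * m) (2 * m - m * e - b) (2 * a) (2 * a - a * e - c)"
    using h unfolding has_periods_phases_def by auto
  then show ?thesis by blast
qed

theorem ex1_periods_phases:
  assumes "scenario w"
  shows "\<exists>!(A\<^sub>M, B\<^sub>M, A\<^sub>N, B\<^sub>N). has_periods_phases w A\<^sub>M B\<^sub>M A\<^sub>N B\<^sub>N"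
  using ex_periods_phases[OF assms] has_periods_phases_unique[of w]
  by (auto simp: Ex1_def) blast+

lemma periods_phases_eqI:
  assumes "has_periods_phases w A\<^sub>M B\<^sub>M A\<^sub>N B\<^sub>N"
  shows "startperiod w = A\<^sub>M" "startphase w = B\<^sub>M" "endperiod w = A\<^sub>N" "endphase w = B\<^sub>N"
  unfolding startperiod_def startphase_def endperiod_def endphase_def
  using assms by (blast intro!: the_equality dest: has_periods_phases_unique)+

lemma has_periods_phases:
  assumes "scenario w"
  shows "has_periods_phases w (startperiod w) (startphase w) (endperiod w) (endphase w)"
  using ex_periods_phases[OF assms] periods_phases_eqI[of w] by auto

end

(* The k-th realization of S ends in N_k, and S s is realized exactly by those realizations of S for
   which (3 N_k + 1) / 2 = 3 (A_N / 2) k - (3 B_N - 1) / 2 is odd. As A_N / 2 is odd, this selects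
   every second k: the even ones if (3 B_N - 1) / 2 is odd, the odd ones otherwise. *)
theory Submission
  imports Defs
begin

lemma realization_iff_orbit:
  "realization w xs \<longleftrightarrow> orbit w xs \<and> odd (hd xs) \<and> odd (last xs)"
  by (auto simp: realization_def orbit_def)

lemma orbit_nonempty: "orbit w xs \<Longrightarrow> xs \<noteq> []"
  by (auto simp: orbit_def)

lemma orbit_scenario_odd_hd:
  assumes "scenario w" "orbit w xs"
  shows "odd (hd xs)"
proof -
  have "w \<noteq> []" "w ! 0 = Spike"
    using assms(1) by (auto simp: scenario_def hd_conv_nth)
  moreover have "xs \<noteq> []" "applicable (w ! 0) (xs ! 0)"
    using assms(2) \<open>w \<noteq> []\<close> by (auto simp: orbit_def)
  ultimately show ?thesis by (simp add: hd_conv_nth)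
qed

text \<open>The final \<open>Spike\<close> applies exactly when the number before it is odd, so
  removing the last entry leaves a realization of \<open>w\<close> and not merely an orbit.\<close>

lemma realization_snoc_Spike:
  "realization (w @ [Spike]) zs \<longleftrightarrow>
     (\<exists>xs. realization w xs \<and> odd ((3 * last xs + 1) div 2) \<and> zs = xs @ [(3 * last xs + 1) div 2])"
  unfolding realization_iff_orbit orbit_snoc using orbit_nonempty by auto

text \<open>\<open>has_periods_phases\<close> records only that \<open>A\<^sub>N\<close> is even.
  The sharper fact comes from \<open>orbit_param\<close>: final entries of orbits run through
  \<open>a * j + c\<close> with \<open>a\<close> odd, and odd ones at distance \<open>2 * a\<close>
  are both endnumbers. Hence \<open>A\<^sub>N\<close> divides \<open>2 * a\<close>, which 4 does not
  divide.\<close>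

lemma not_4_dvd_endperiod:
  assumes "scenario w" and "has_periods_phases w A\<^sub>M B\<^sub>M A\<^sub>N B\<^sub>N"
  shows "\<not> 4 dvd A\<^sub>N"
proof
  assume "4 dvd A\<^sub>N"
  obtain R where R: "R ` {1..} = {xs. realization w xs}"
    "\<And>k. k \<ge> 1 \<Longrightarrow> last (R k) = A\<^sub>N * int k - B\<^sub>N"
    using assms(2) by (auto simp: has_periods_phases_def lists_realizations_def)
  obtain f b c a m where f: "odd (a::int)" "{xs. orbit w xs} = f ` {0::int..}"
    "\<And>j. j \<ge> 0 \<Longrightarrow> hd (f j) = m * j + b \<and> last (f j) = a * j + c"
    using orbit_param[of w] by blast
  have fin: "\<exists>k. a * j + c = A\<^sub>N * int k - B\<^sub>N" if "j \<ge> 0" "odd (a * j + c)" for j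
  proof -
    have "orbit w (f j)" using f(2) that by blast
    moreover have "odd (last (f j))" using f(3) that by simp
    ultimately have "realization w (f j)"
      using orbit_scenario_odd_hd[OF assms(1)] realization_iff_orbit by blast
    then obtain k where "k \<ge> 1" "f j = R k" using R(1) by auto
    then show ?thesis using R(2) f(3) that by metis
  qed
  \<comment> \<open>The least index \<open>j\<close> with \<open>a * j + c\<close> odd;
    \<open>e + 2\<close> is the next one.\<close>
  define e :: int where "e = (if odd c then 0 else 1)"
  have e: "e \<ge> 0" "odd (a * e + c)" using f(1) by (auto simp: e_def)
  obtain k where k: "a * e + c = A\<^sub>N * int k - B\<^sub>N" using fin e by blast
  have "odd (a * (e + 2) + c)" using e by (simp add: distrib_left)
  then obtain l where l: "a * (e + 2) + c = A\<^sub>N * int l - B\<^sub>N" using fin[of "e + 2"] e by auto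
  have "2 * a = A\<^sub>N * (int l - int k)" using k l by (simp add: algebra_simps)
  then have "4 dvd 2 * a" using \<open>4 dvd A\<^sub>N\<close> by simp
  then show False using f(1) by presburger
qed

text \<open>Both cases are handled at once: \<open>e\<close> is the index shift, and realization
  number \<open>i\<close> of the longer word extends realization number \<open>2 * i - e\<close> of
  \<open>w\<close>.\<close>

lemma has_periods_phases_snoc_Spike:
  fixes e :: nat
  assumes S: "scenario w" and h: "has_periods_phases w A\<^sub>M B\<^sub>M A\<^sub>N B\<^sub>N"
    and e: "e = (if odd ((3 * B\<^sub>N - 1) div 2) then 0 else 1)"
  shows "has_periods_phases (w @ [Spike]) (2 * A\<^sub>M) (B\<^sub>M + int e * A\<^sub>M)
           (3 * A\<^sub>N) ((3 * B\<^sub>N + 3 * int e * A\<^sub>N - 1) div 2)"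
proof -
  obtain R where R: "R ` {1..} = {xs. realization w xs}" "strict_mono_on {1..} (\<lambda>k. hd (R k))"
    "\<And>k. k \<ge> 1 \<Longrightarrow> hd (R k) = A\<^sub>M * int k - B\<^sub>M \<and> last (R k) = A\<^sub>N * int k - B\<^sub>N"
    using h by (auto simp: has_periods_phases_def lists_realizations_def)
  have par: "even A\<^sub>M" "odd B\<^sub>M" "even A\<^sub>N" "odd B\<^sub>N"
    using h by (auto simp: has_periods_phases_def)
  obtain \<alpha> where \<alpha>: "A\<^sub>N = 2 * \<alpha>" using par by blast
  have "odd \<alpha>" using not_4_dvd_endperiod[OF S h] \<alpha> by auto
  \<comment> \<open>With \<alpha> and \<beta> naming the halves, every \<open>div 2\<close> below
    becomes exact.\<close>
  obtain \<beta> where \<beta>: "3 * B\<^sub>N - 1 = 2 * \<beta>"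
    using par by (metis dvdE even_mult_iff even_numeral odd_numeral odd_one odd_even_add even_diff)
  have e': "odd (\<beta> + int e)" "e \<le> 1" using e \<beta> by auto
  define g where "g xs = xs @ [(3 * last xs + 1) div 2]" for xs :: "int list"
  have spike: "(3 * last (R k) + 1) div 2 = 3 * \<alpha> * int k - \<beta>" if "k \<ge> 1" for k
  proof -
    have "3 * last (R k) + 1 = 2 * (3 * \<alpha> * int k - \<beta>)"
      using R(3)[OF that] \<alpha> \<beta> by (simp add: algebra_simps)
    then show ?thesis by simp
  qed
  \<comment> \<open>As \<alpha> is odd, \<open>3 * \<alpha> * int k - \<beta>\<close> has the parity
    of k + \<beta>, and \<beta> has the parity opposite to \<open>e\<close>.\<close>
  have odd_spike: "odd ((3 * last (R k) + 1) div 2) \<longleftrightarrow> even (k + e)" if "k \<ge> 1" for k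
    using e' \<open>odd \<alpha>\<close> by (auto simp: spike[OF that])
  define Q where "Q i = g (R (2 * i - e))" for i
  \<comment> \<open>Subtraction on \<open>nat\<close> truncates; \<open>e \<le> 1\<close> keeps
    \<open>2 * i - e\<close> a genuine difference and a valid index.\<close>
  have ge1: "2 * i - e \<ge> 1" if "i \<ge> 1" for i using that e' by simp
  have im: "Q ` {1..} = {zs. realization (w @ [Spike]) zs}"
  proof (intro set_eqI iffI)
    fix zs assume "zs \<in> Q ` {1..}"
    then obtain i where i: "i \<ge> 1" "zs = Q i" by auto
    have "R (2 * i - e) \<in> {xs. realization w xs}" using R(1) ge1[OF i(1)] by auto
    moreover have "even (2 * i - e + e)" using ge1[OF i(1)] by simp
    ultimately show "zs \<in> {zs. realization (w @ [Spike]) zs}"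
      using odd_spike[OF ge1[OF i(1)]] i(2) by (auto simp: realization_snoc_Spike Q_def g_def)
  next
    fix zs assume "zs \<in> {zs. realization (w @ [Spike]) zs}"
    then obtain xs where xs: "realization w xs" "odd ((3 * last xs + 1) div 2)" "zs = g xs"
      by (auto simp: realization_snoc_Spike g_def)
    then obtain k where k: "k \<ge> 1" "xs = R k" using R(1) by auto
    then have "even (k + e)" using odd_spike xs(2) by blast
    then obtain i where i: "k + e = 2 * i" by blast
    then have "k = 2 * i - e" "i \<ge> 1" using k(1) by auto
    then show "zs \<in> Q ` {1..}" using xs(3) k(2) by (auto simp: Q_def)
  qed
  have hd_Q: "hd (Q i) = hd (R (2 * i - e))" if "i \<ge> 1" for i
  proof -
    have "R (2 * i - e) \<in> {xs. realization w xs}" using R(1) ge1[OF that] by auto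
    then have "R (2 * i - e) \<noteq> []" using realization_iff_orbit orbit_nonempty by blast
    then show ?thesis by (simp add: Q_def g_def)
  qed
  \<comment> \<open>Substituting k = 2i - e into a progression doubles its period and adds
    \<open>e\<close> times the old period to its phase. For endnumbers the progression is the one in
    \<open>spike\<close>, with period 3\<alpha> and phase \<beta>.\<close>
  have vals: "hd (Q i) = 2 * A\<^sub>M * int i - (B\<^sub>M + int e * A\<^sub>M) \<and>
      last (Q i) = 3 * A\<^sub>N * int i - (3 * B\<^sub>N + 3 * int e * A\<^sub>N - 1) div 2" if "i \<ge> 1" for i
  proof -
    have k: "int (2 * i - e) = 2 * int i - int e" using ge1[OF that] by linarith
    have "hd (Q i) = A\<^sub>M * int (2 * i - e) - B\<^sub>M"
      using R(3)[OF ge1[OF that]] hd_Q[OF that] by simp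
    moreover have "last (Q i) = 3 * \<alpha> * int (2 * i - e) - \<beta>"
      using spike[OF ge1[OF that]] by (simp add: Q_def g_def)
    moreover have "3 * B\<^sub>N + 3 * int e * A\<^sub>N - 1 = 2 * (\<beta> + 3 * \<alpha> * int e)"
      using \<alpha> \<beta> by (simp add: algebra_simps)
    ultimately show ?thesis using \<alpha> unfolding k by (simp add: algebra_simps)
  qed
  have "strict_mono_on {1..} (\<lambda>i. hd (Q i))"
  proof (rule strict_mono_onI)
    fix i j :: nat assume ij: "i \<in> {1..}" "j \<in> {1..}" "i < j"
    have "2 * i - e < 2 * j - e" using ij e' by auto
    then have "hd (R (2 * i - e)) < hd (R (2 * j - e))"
      using R(2) ge1[of i] ge1[of j] ij by (auto simp: strict_mono_on_def)
    then show "hd (Q i) < hd (Q j)" using ij hd_Q by simp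
  qed
  with im have "lists_realizations (w @ [Spike]) Q" by (simp add: lists_realizations_def)
  \<comment> \<open>The new endphase is \<beta> + 3\<alpha>e, of the same parity as \<beta> + e,
    which is odd by the choice of \<open>e\<close>.\<close>
  moreover have "odd ((3 * B\<^sub>N + 3 * int e * A\<^sub>N - 1) div 2)"
  proof -
    have "3 * B\<^sub>N + 3 * int e * A\<^sub>N - 1 = 2 * (\<beta> + 3 * \<alpha> * int e)"
      using \<alpha> \<beta> by (simp add: algebra_simps)
    then show ?thesis using e' \<open>odd \<alpha>\<close> by simp
  qed
  ultimately show ?thesis using par vals unfolding has_periods_phases_def by auto
qed

theorem proposition4p1:
  fixes S S' :: "collatz_op list"
    and A\<^sub>M B\<^sub>M A\<^sub>N B\<^sub>N A\<^sub>M' B\<^sub>M' A\<^sub>N' B\<^sub>N' :: int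
  assumes "scenario S"
    and "A\<^sub>M = startperiod S" and "B\<^sub>M = startphase S"
    and "A\<^sub>N = endperiod S" and "B\<^sub>N = endphase S"
    and "S' = S @ [Spike]"
    and "A\<^sub>M' = startperiod S'" and "B\<^sub>M' = startphase S'"
    and "A\<^sub>N' = endperiod S'" and "B\<^sub>N' = endphase S'"
  shows "(odd ((3 * B\<^sub>N - 1) div 2) \<longrightarrow>
            A\<^sub>M' = 2 * A\<^sub>M \<and> B\<^sub>M' = B\<^sub>M \<and>
            A\<^sub>N' = 3 * A\<^sub>N \<and> B\<^sub>N' = (3 * B\<^sub>N - 1) div 2)
       \<and> (even ((3 * B\<^sub>N - 1) div 2) \<longrightarrow>
            A\<^sub>M' = 2 * A\<^sub>M \<and> B\<^sub>M' = B\<^sub>M + A\<^sub>M \<and>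
            A\<^sub>N' = 3 * A\<^sub>N \<and> B\<^sub>N' = (3 * B\<^sub>N + 3 * A\<^sub>N - 1) div 2)"
proof -
  define e :: nat where "e = (if odd ((3 * B\<^sub>N - 1) div 2) then 0 else 1)"
  have "has_periods_phases S A\<^sub>M B\<^sub>M A\<^sub>N B\<^sub>N"
    using has_periods_phases[OF assms(1)] assms(2-5) by simp
  \<comment> \<open>Periods and phases are unique, so one valid quadruple for \<open>S'\<close>
    determines all four descriptions.\<close>
  from periods_phases_eqI[OF has_periods_phases_snoc_Spike[OF assms(1) this e_def]]
  have "A\<^sub>M' = 2 * A\<^sub>M \<and> B\<^sub>M' = B\<^sub>M + int e * A\<^sub>M \<and> A\<^sub>N' = 3 * A\<^sub>N \<and>
      B\<^sub>N' = (3 * B\<^sub>N + 3 * int e * A\<^sub>N - 1) div 2"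
    using assms(6-10) by simp
  then show ?thesis by (auto simp: e_def)
qed

end
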